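(* The Gaussian integers $\mathbb{Z}[i]\subset\mathbb{C}=\mathbb{E}^2$ and the Eisenstein integers $\mathbb{Z}\bigl[\frac{1+\sqrt{-3}}{2}\bigr]\subset\mathbb{C}=\mathbb{E}^2$ are, up to scalar multiples (and isometry), the only lattices in dimension two with vanishing $\Theta$-differential. That is, for a lattice $\Lambda\subset\mathbb{E}^2$ of rank two with Gram matrix $A$, one has $\partial_B\Theta_A=0$ for all $B\in T_A^0$ if and only if $\Lambda=c\,\varphi(\Lambda_0)$ for some real $c>0$, some $\varphi\in\mathrm{O}(2)$ and some $\Lambda_0\in\bigl\{\mathbb{Z}[i],\ \mathbb{Z}\bigl[\frac{1+\sqrt{-3}}{2}\bigr]\bigr\}$.
   Context: $\mathbb{E}^2$ is the Euclidean plane, identified with $\mathbb{C}$. For a positive definite symmetric real $2\times2$ matrix $A$, $\Theta_A(z)=\sum_{\lambda\in\mathbb{Z}^2}\exp(2\pi i({}^t\lambda A\lambda)z)$ on the upper half plane; for a symmetric real matrix $B$, $\partial_B\Theta_A(z)=\frac{1}{2\pi iz}\frac{\partial}{\partial t}\Theta_{A+tB}(z)|_{t=0}=\sum_{\lambda\in\mathbb{Z}^2}({}^t\lambda B\lambda)\exp(2\pi i({}^t\lambda A\lambda)z)$. $T_A^0=\{B\text{ symmetric}:\mathrm{tr}(BA^{-1})=0\}$ is the space of infinitesimal deformations with fixed discriminant. The $\Theta$-differential at $A$ is said to vanish if $\partial_B\Theta_A=0$ for all $B\in T_A^0$. The Gram matrix of $\Lambda$ is $A={}^tQQ$, where the columns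 of $Q$ form a basis of $\Lambda$; the condition does not depend on the choice of basis. *)

theory Defs
  imports "HOL-Analysis.Analysis" "HOL-Computational_Algebra.Polynomial"
begin

definition real_vec :: "int ^ 'n \<Rightarrow> real ^ 'n" where
  "real_vec l = (\<chi> i. real_of_int (l $ i))"

definition qform :: "real ^ 'n ^ 'n \<Rightarrow> int ^ 'n \<Rightarrow> real" where
  "qform A l = real_vec l \<bullet> (A *v real_vec l)"

text \<open>The series is meaningful for positive definite \<open>A\<close> and \<open>Im z > 0\<close>.\<close>

definition Theta :: "real ^ 2 ^ 2 \<Rightarrow> complex \<Rightarrow> complex" where
  "Theta A z = (\<Sum>\<^sub>\<infinity>l\<in>UNIV. exp (2 * of_real pi * \<i> * of_real (qform A l) * z))"

text \<open>
  The parameter \<open>t\<close> is real. For positive definite \<open>A\<close> and symmetric \<open>B\<close>, the matrix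
  \<open>A + t B\<close> stays positive definite for small \<open>t\<close>, so only meaningful values of
  \<open>Theta\<close> enter the derivative at \<open>0\<close>.
\<close>

definition Theta_deriv :: "real ^ 2 ^ 2 \<Rightarrow> real ^ 2 ^ 2 \<Rightarrow> complex \<Rightarrow> complex" where
  "Theta_deriv B A z =
     1 / (2 * of_real pi * \<i> * z) * vector_derivative (\<lambda>t::real. Theta (A + t *\<^sub>R B) z) (at 0)"

definition fixed_disc_deformations :: "real ^ 'n ^ 'n \<Rightarrow> (real ^ 'n ^ 'n) set" where
  "fixed_disc_deformations A = {B. transpose B = B \<and> trace (B ** matrix_inv A) = 0}"

definition Theta_differential_vanishes :: "real ^ 2 ^ 2 \<Rightarrow> bool" where
  "Theta_differential_vanishes A \<longleftrightarrow>
     (\<forall>B \<in> fixed_disc_deformations A. \<forall>z. Im z > 0 \<longrightarrow> Theta_deriv B A z = 0)"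

definition plane_to_complex :: "real ^ 2 \<Rightarrow> complex" where
  "plane_to_complex v = Complex (v $ 1) (v $ 2)"

text \<open>
  \<open>\<Lambda>\<close> is a lattice of rank two, and the columns of \<open>Q\<close> form a basis of it over the integers.
\<close>

definition lattice_basis :: "complex set \<Rightarrow> real ^ 2 ^ 2 \<Rightarrow> bool" where
  "lattice_basis \<Lambda> Q \<longleftrightarrow>
     invertible Q \<and> \<Lambda> = range (\<lambda>l :: int ^ 2. plane_to_complex (Q *v real_vec l))"

definition gram_matrix :: "real ^ 'n ^ 'n \<Rightarrow> real ^ 'n ^ 'n" where
  "gram_matrix Q = transpose Q ** Q"

text \<open>The ring \<open>\<int>[x]\<close>: all values at \<open>x\<close> of integer polynomials.\<close>

definition adjoin_int :: "complex \<Rightarrow> complex set" where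
  "adjoin_int x = range (\<lambda>p :: int poly. poly (map_poly of_int p) x)"

definition gaussian_integers :: "complex set" where
  "gaussian_integers = adjoin_int \<i>"

definition eisenstein_integers :: "complex set" where
  "eisenstein_integers = adjoin_int ((1 + csqrt (- 3)) / 2)"

end

theory Submission
  imports Defs
begin

text \<open>
  Let \<open>Q\<close> be a basis matrix of \<open>\<Lambda>\<close> and \<open>A\<close> its Gram matrix. In the coordinates given by \<open>Q\<close>, a
  deformation \<open>B\<close> of fixed discriminant becomes a traceless symmetric matrix, and these are exactly
  the quadratic forms \<open>u \<mapsto> Re (a u\<^sup>2)\<close> on the complex plane, with \<open>a\<close> an arbitrary complex number.
  Differentiating the theta series term by term, the \<open>\<Theta>\<close>-differential at \<open>A\<close> therefore vanishes if and
  only if the single function \<open>z \<mapsto> \<Sum>u\<in>\<Lambda>. u\<^sup>2 exp (2 \<pi> i |u|\<^sup>2 z)\<close> vanishes on the upper half plane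
  (\<open>Theta_differential_vanishes_iff_moment\<close>).

  If \<open>\<Lambda>\<close> is similar to one of the two rings, it is mapped to itself by the multiplication with a
  unit \<open>\<omega>\<close> of order four or six. Replacing \<open>u\<close> by \<open>\<omega> u\<close> multiplies the function by \<open>\<omega>\<^sup>2 \<noteq> 1\<close> without
  changing the sum, so the function is zero (\<open>moment_zero_of_similar\<close>). A reflection in the similarity
  does no harm, because both rings are closed under complex conjugation.

  Conversely, let \<open>z\<close> tend to infinity along the imaginary axis. The shortest nonzero vectors dominate
  the sum, so their squares add up to zero (\<open>shortest_vectors_balanced\<close>). Take two shortest vectors
  \<open>v\<close> and \<open>w = \<omega> v\<close> that are not parallel, with \<open>Re \<omega> \<ge> 0\<close>. Since \<open>w - v\<close> is not shorter than \<open>v\<close>,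
  \<open>0 \<le> Re \<omega> \<le> 1/2\<close>, and then \<open>v\<close> and \<open>w\<close> generate \<open>\<Lambda>\<close>. If \<open>Re \<omega> = 1/2\<close>, then \<open>\<Lambda>\<close> is hexagonal. Otherwise
  the only shortest vectors are \<open>\<plusminus>v\<close> and \<open>\<plusminus>w\<close>, hence \<open>v\<^sup>2 + w\<^sup>2 = 0\<close>, \<open>\<omega> = \<plusminus>i\<close>, and \<open>\<Lambda>\<close> is square
  (\<open>balanced_shortest_vectors_imp_gaussian_or_eisenstein\<close>).
\<close>

section \<open>Gaussian sums over a lattice\<close>

text \<open>
  Gives the constant with which a polynomial factor in a Gaussian sum is absorbed by a part of the
  exponential. It comes from raising \<open>x \<le> exp x\<close> to the power \<open>n\<close> at \<open>x = c r / (n + 1)\<close>; dividing by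
  \<open>n + 1\<close> instead of \<open>n\<close> includes the case \<open>n = 0\<close>.
\<close>

lemma power_le_exp:
  fixes r c :: real
  assumes "r \<ge> 0" "c > 0"
  shows "r ^ n \<le> (real (Suc n) / c) ^ n * exp (c * r)"
proof -
  define x where "x = c * r / real (Suc n)"
  have x: "x \<ge> 0" "real (Suc n) * x = c * r"
    using assms by (auto simp: x_def)
  have "r ^ n = (real (Suc n) / c) ^ n * x ^ n"
    using assms by (simp add: x_def power_mult_distrib[symmetric] del: of_nat_Suc)
  also have "x ^ n \<le> exp x ^ n"
    using exp_ge_add_one_self[of x] x(1) by (intro power_mono) linarith+
  also have "exp x ^ n = exp (real n * x)"
    by (simp add: exp_of_nat_mult)
  also have "\<dots> \<le> exp (c * r)"
    using x by (simp flip: x(2) add: mult_right_mono)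
  finally show ?thesis
    using assms by (simp add: mult_left_mono)
qed

lemma summable_on_exp_abs_int:
  assumes "c > 0"
  shows "(\<lambda>n::int. exp (- c * \<bar>of_int n\<bar> :: real)) summable_on UNIV"
proof -
  let ?f = "\<lambda>n::int. exp (- c * \<bar>of_int n\<bar> :: real)"
  have "summable (\<lambda>n. exp (- c) ^ n)"
    using assms by (intro summable_geometric) auto
  then have nat: "(\<lambda>n::nat. exp (- c * real n)) summable_on UNIV"
    by (subst summable_on_UNIV_nonneg_real_iff) (auto simp: exp_of_nat_mult[symmetric] mult_ac)
  have "?f summable_on range int"
    using nat by (subst summable_on_reindex) (auto simp: o_def)
  moreover have "?f summable_on range (\<lambda>n. - int n)"
    using nat by (subst summable_on_reindex) (auto simp: o_def inj_def)
  moreover have "(UNIV :: int set) = range int \<union> range (\<lambda>n. - int n)"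
    by (auto intro: int_cases2)
  ultimately show ?thesis
    by (metis summable_on_union)
qed

lemma summable_on_exp_abs_int2:
  assumes "c > 0"
  shows "(\<lambda>l :: int ^ 2. exp (- c * (\<bar>of_int (l $ 1)\<bar> + \<bar>of_int (l $ 2)\<bar>) :: real)) summable_on UNIV"
proof -
  let ?e = "\<lambda>n::int. exp (- c * \<bar>of_int n\<bar> :: real)"
  have "(\<lambda>(m, n). ?e m * ?e n) summable_on UNIV \<times> UNIV"
  proof (rule summable_on_SigmaI)
    show "((\<lambda>n. case (m, n) of (m, n) \<Rightarrow> ?e m * ?e n) has_sum ?e m * infsum ?e UNIV) UNIV" for m
      using summable_on_exp_abs_int[OF assms] by (auto intro: has_sum_cmult_right)
    show "(\<lambda>m. ?e m * infsum ?e UNIV) summable_on UNIV"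
      using summable_on_exp_abs_int[OF assms] by (intro summable_on_cmult_left)
  qed auto
  moreover have "bij_betw (\<lambda>l :: int ^ 2. (l $ 1, l $ 2)) UNIV (UNIV \<times> UNIV)"
    by (rule bij_betwI[of _ _ _ "\<lambda>(m, n). vector [m, n]"]) (auto simp: vec_eq_iff forall_2)
  ultimately have "(\<lambda>l :: int ^ 2. ?e (l $ 1) * ?e (l $ 2)) summable_on UNIV"
    by (subst (asm) summable_on_reindex_bij_betw[symmetric]) auto
  then show ?thesis
    by (simp add: algebra_simps exp_add exp_diff exp_minus divide_simps)
qed

lemma norm_plane_to_complex: "norm (plane_to_complex v) = norm v"
  by (simp add: plane_to_complex_def cmod_def norm_vec_def L2_set_def sum_2)

lemma plane_to_complex_inj: "plane_to_complex v = plane_to_complex w \<longleftrightarrow> v = w"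
  by (simp add: plane_to_complex_def vec_eq_iff forall_2)

lemma lattice_basis_bij_betw:
  assumes "lattice_basis \<Lambda> Q"
  shows "bij_betw (\<lambda>l. plane_to_complex (Q *v real_vec l)) UNIV \<Lambda>"
proof -
  have "inj ((*v) Q)"
    using assms by (auto simp: lattice_basis_def inj_matrix_vector_mult)
  moreover have "inj (real_vec :: int ^ 2 \<Rightarrow> real ^ 2)"
    by (rule injI) (simp add: real_vec_def vec_eq_iff)
  ultimately have "inj (\<lambda>l. plane_to_complex (Q *v real_vec l))"
    by (intro injI) (simp add: plane_to_complex_inj inj_eq)
  with assms show ?thesis
    by (auto simp: lattice_basis_def bij_betw_def)
qed

text \<open>
  A basis matrix is bounded below, so the squared length of a lattice vector is at least a constant
  times \<open>m\<^sup>2 + n\<^sup>2 \<ge> |m| + |n|\<close> for its integer coordinates \<open>m\<close> and \<open>n\<close>. The sum is thus dominated by a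
  product of two geometric series.
\<close>

lemma lattice_gaussian_summable:
  assumes "lattice_basis \<Lambda> Q" "c > 0"
  shows "(\<lambda>u. ((norm u)\<^sup>2) ^ n * exp (- c * (norm u)\<^sup>2)) summable_on \<Lambda>"
proof -
  have "inj ((*v) Q)"
    using assms by (auto simp: lattice_basis_def inj_matrix_vector_mult)
  then obtain k where k: "k > 0" "\<And>x. k * norm x \<le> norm (Q *v x)"
    using linear_inj_bounded_below_pos[OF matrix_vector_mul_linear] by blast
  \<comment> \<open>Half of the exponent absorbs the polynomial factor, the other half gives the convergence.\<close>
  define d where "d = c / 2 * k\<^sup>2"
  have d: "d > 0"
    using k assms by (simp add: d_def)
  define C where "C = (real (Suc n) / (c / 2)) ^ n"
  have C: "C \<ge> 0"
    using assms by (simp add: C_def)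
  let ?P = "\<lambda>l. plane_to_complex (Q *v real_vec l)"
  let ?f = "\<lambda>u::complex. ((norm u)\<^sup>2) ^ n * exp (- c * (norm u)\<^sup>2)"
  have "?f (?P l) \<le> C * exp (- d * (\<bar>of_int (l $ 1)\<bar> + \<bar>of_int (l $ 2)\<bar>))" for l
  proof -
    have int: "\<bar>of_int m\<bar> \<le> (of_int m :: real)\<^sup>2" for m
    proof -
      have "\<bar>m\<bar> \<le> m\<^sup>2"
        using mult_left_mono[of 1 "\<bar>m\<bar>" "\<bar>m\<bar>"] by (cases "m = 0") (auto simp: power2_eq_square abs_mult[symmetric])
      then show ?thesis
        by (metis of_int_abs of_int_le_iff of_int_power)
    qed
    have "?f (?P l) \<le> C * exp (c / 2 * (norm (?P l))\<^sup>2) * exp (- c * (norm (?P l))\<^sup>2)"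
      using power_le_exp[of "(norm (?P l))\<^sup>2" "c / 2" n] assms(2)
      by (intro mult_right_mono) (simp_all only: C_def, auto)
    also have "\<dots> = C * exp (- (c / 2) * (norm (?P l))\<^sup>2)"
      by (simp add: exp_add[symmetric] field_simps)
    also have "\<dots> \<le> C * exp (- d * (\<bar>of_int (l $ 1)\<bar> + \<bar>of_int (l $ 2)\<bar>))"
    proof -
      have "k\<^sup>2 * (\<bar>of_int (l $ 1)\<bar> + \<bar>of_int (l $ 2)\<bar>) \<le> k\<^sup>2 * (norm (real_vec l))\<^sup>2"
        using int[of "l $ 1"] int[of "l $ 2"]
        by (intro mult_left_mono) (auto simp: norm_vec_def L2_set_def sum_2 real_vec_def)
      also have "\<dots> \<le> (norm (?P l))\<^sup>2"
        using k by (auto simp: norm_plane_to_complex power_mult_distrib[symmetric] intro!: power_mono)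
      finally have "c / 2 * (k\<^sup>2 * (\<bar>of_int (l $ 1)\<bar> + \<bar>of_int (l $ 2)\<bar>)) \<le> c / 2 * (norm (?P l))\<^sup>2"
        using assms by (intro mult_left_mono) auto
      then show ?thesis
        using C by (intro mult_left_mono) (auto simp: d_def mult_ac)
    qed
    finally show ?thesis .
  qed
  then have "(\<lambda>l. ?f (?P l)) summable_on UNIV"
    by (intro summable_on_comparison_test[OF summable_on_cmult_right[OF summable_on_exp_abs_int2[OF d], of C]]) auto
  then show ?thesis
    using summable_on_reindex_bij_betw[OF lattice_basis_bij_betw[OF assms(1)], of ?f] by simp
qed

text \<open>
  Discreteness of the lattice is read off from the convergence of the Gaussian sum: every vector in
  the ball contributes at least \<open>exp (- r\<^sup>2)\<close>.
\<close>

lemma lattice_finite_ball: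
  assumes "lattice_basis \<Lambda> Q"
  shows "finite {u \<in> \<Lambda>. norm u \<le> r}"
proof (rule ccontr)
  let ?f = "\<lambda>u::complex. exp (- (norm u)\<^sup>2)" and ?S = "{u \<in> \<Lambda>. norm u \<le> r}"
  have sum: "?f summable_on \<Lambda>"
    using lattice_gaussian_summable[OF assms, of 1 0] by simp
  assume "infinite ?S"
  obtain N :: nat where N: "N > infsum ?f \<Lambda> / exp (- r\<^sup>2)"
    using reals_Archimedean2 by blast
  obtain F where F: "F \<subseteq> ?S" "finite F" "card F = N"
    using infinite_arbitrarily_large[OF \<open>infinite ?S\<close>] by blast
  have "real N * exp (- r\<^sup>2) \<le> sum ?f F"
    using F sum_bounded_below[of F "exp (- r\<^sup>2)" ?f] by (auto simp: subset_iff power_mono)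
  also have "\<dots> \<le> infsum ?f \<Lambda>"
    using F by (intro finite_sum_le_infsum[OF sum]) auto
  finally show False
    using N by (simp add: field_simps)
qed

section \<open>The derivative of the theta series\<close>

text \<open>
  Term-by-term differentiation at \<open>0\<close>. The second-order Taylor remainder of the \<open>i\<close>-th term is at most
  \<open>t\<^sup>2\<close> times the \<open>i\<close>-th term of the last series in the hypotheses, so the remainders add up to
  something quadratic in \<open>t\<close>.
\<close>

lemma has_vector_derivative_infsum_exp:
  fixes g w :: "'i \<Rightarrow> complex" and e :: real
  assumes "e > 0"
    and g: "g summable_on I"
    and gw: "(\<lambda>i. g i * w i) summable_on I"
    and rem: "(\<lambda>i. norm (g i) * (norm (w i))\<^sup>2 * exp (e * norm (w i))) summable_on I"
  shows "((\<lambda>t::real. \<Sum>\<^sub>\<infinity>i\<in>I. g i * exp (of_real t * w i)) has_vector_derivative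
           (\<Sum>\<^sub>\<infinity>i\<in>I. g i * w i)) (at 0)"
proof -
  let ?f = "\<lambda>t::real. \<Sum>\<^sub>\<infinity>i\<in>I. g i * exp (of_real t * w i)"
  let ?M = "\<lambda>i. norm (g i) * (norm (w i))\<^sup>2 * exp (e * norm (w i))"
  define R where "R t i = g i * (exp (of_real t * w i) - (1 + of_real t * w i))" for t :: real and i
  have R: "norm (R t i) \<le> t\<^sup>2 * ?M i" if "\<bar>t\<bar> < e" for t i
  proof -
    have "norm (exp (of_real t * w i) - (1 + of_real t * w i))
            \<le> exp (norm (of_real t * w i)) * (norm (of_real t * w i))\<^sup>2"
      using Taylor_exp_field[of "of_real t * w i" 1] by (simp add: power2_eq_square)
    also have "\<dots> \<le> exp (e * norm (w i)) * (norm (of_real t * w i))\<^sup>2"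
      using that by (intro mult_right_mono) (auto simp: norm_mult intro: mult_right_mono)
    finally have "norm (g i) * norm (exp (of_real t * w i) - (1 + of_real t * w i))
        \<le> norm (g i) * (exp (e * norm (w i)) * (norm (of_real t * w i))\<^sup>2)"
      by (rule mult_left_mono) auto
    then show ?thesis
      by (simp add: R_def norm_mult power_mult_distrib mult_ac)
  qed
  have bound: "norm (?f t - ?f 0 - t *\<^sub>R (\<Sum>\<^sub>\<infinity>i\<in>I. g i * w i)) \<le> t\<^sup>2 * infsum ?M I"
    if t: "\<bar>t\<bar> < e" for t
  proof -
    have Rn: "(\<lambda>i. norm (R t i)) summable_on I"
      by (rule Infinite_Sum.abs_summable_on_comparison_test'[OF summable_on_cmult_right[OF rem, of "t\<^sup>2"] R[OF t]])
    then have Rs: "R t summable_on I"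
      by (rule abs_summable_summable)
    have gtw: "(\<lambda>i. of_real t * (g i * w i)) summable_on I"
      by (rule summable_on_cmult_right[OF gw])
    have "?f t = (\<Sum>\<^sub>\<infinity>i\<in>I. (g i + of_real t * (g i * w i)) + R t i)"
      by (rule infsum_cong) (simp add: R_def algebra_simps)
    also have "\<dots> = infsum g I + of_real t * (\<Sum>\<^sub>\<infinity>i\<in>I. g i * w i) + infsum (R t) I"
      using g gtw Rs by (simp add: infsum_add summable_on_add infsum_cmult_right')
    finally have "?f t - ?f 0 - t *\<^sub>R (\<Sum>\<^sub>\<infinity>i\<in>I. g i * w i) = infsum (R t) I"
      by (simp add: scaleR_conv_of_real)
    also have "norm \<dots> \<le> (\<Sum>\<^sub>\<infinity>i\<in>I. norm (R t i))"
      by (rule norm_infsum_bound[OF Rn])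
    also have "\<dots> \<le> (\<Sum>\<^sub>\<infinity>i\<in>I. t\<^sup>2 * ?M i)"
      by (rule infsum_mono[OF Rn summable_on_cmult_right[OF rem] R[OF t]])
    finally show ?thesis
      by (simp add: infsum_cmult_right')
  qed
  show ?thesis
    unfolding has_vector_derivative_def
  proof (rule has_derivativeI_sandwich[OF \<open>e > 0\<close>])
    show "bounded_linear (\<lambda>x::real. x *\<^sub>R (\<Sum>\<^sub>\<infinity>i\<in>I. g i * w i))"
      by (rule bounded_linear_scaleR_left)
    show "((\<lambda>t. \<bar>t\<bar> * infsum ?M I) \<longlongrightarrow> 0) (at 0)"
      by (auto intro!: tendsto_eq_intros)
    fix t :: real
    assume "t \<noteq> 0" "dist t 0 < e"
    then show "norm (?f t - ?f 0 - (t - 0) *\<^sub>R (\<Sum>\<^sub>\<infinity>i\<in>I. g i * w i)) / norm (t - 0) \<le> \<bar>t\<bar> * infsum ?M I"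
      using bound[of t] by (simp add: divide_le_eq power2_eq_square abs_mult[symmetric] mult_ac)
  qed
qed

lemma quadratic_form_congruence:
  fixes Q M :: "real ^ 'n ^ 'n"
  shows "qform (transpose Q ** M ** Q) l = (Q *v real_vec l) \<bullet> (M *v (Q *v real_vec l))"
proof -
  have "x \<bullet> (transpose Q *v y) = (Q *v x) \<bullet> y" for x y :: "real ^ 'n"
    by (metis dot_lmul_matrix vector_transpose_matrix)
  then show ?thesis
    by (simp add: qform_def matrix_vector_mul_assoc[symmetric])
qed

lemma qform_gram_matrix: "qform (gram_matrix Q) l = (norm (plane_to_complex (Q *v real_vec l)))\<^sup>2"
  using quadratic_form_congruence[of Q "mat 1" l]
  by (simp add: gram_matrix_def norm_plane_to_complex power2_norm_eq_inner)

text \<open>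
  The single complex coefficient lets all traceless forms be tested at once through the one complex
  series of the squares \<open>u\<^sup>2\<close>.
\<close>

lemma traceless_symmetric_form:
  fixes M :: "real ^ 2 ^ 2"
  assumes "transpose M = M" "trace M = 0"
  shows "v \<bullet> (M *v v) = Re (Complex (M $ 1 $ 1) (- (M $ 1 $ 2)) * (plane_to_complex v)\<^sup>2)"
proof -
  have "M $ 2 $ 1 = M $ 1 $ 2"
    using arg_cong[OF assms(1), of "\<lambda>N. N $ 1 $ 2"] by (simp add: transpose_def)
  moreover have "M $ 2 $ 2 = - M $ 1 $ 1"
    using assms(2) by (simp add: trace_def sum_2)
  ultimately show ?thesis
    by (simp add: plane_to_complex_def inner_vec_def matrix_vector_mult_def sum_2 power2_eq_square algebra_simps)
qed

lemma matrix_inv_eqI: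
  fixes A :: "real ^ 'n ^ 'n"
  assumes "A ** X = mat 1" "X ** A = mat 1"
  shows "matrix_inv A = X"
  unfolding matrix_inv_def
proof (rule some_equality)
  fix Y assume "A ** Y = mat 1 \<and> Y ** A = mat 1"
  then show "Y = X"
    by (metis assms(1) matrix_mul_assoc matrix_mul_lid matrix_mul_rid)
qed (use assms in simp)

text \<open>
  Passing from lattice coordinates to orthonormal ones turns \<open>A\<close> into the identity and the condition
  \<open>tr (B A\<^sup>-\<^sup>1) = 0\<close> into \<open>tr M = 0\<close>.
\<close>

lemma fixed_disc_deformations_gram_matrix:
  fixes Q :: "real ^ 'n ^ 'n"
  assumes "invertible Q"
  shows "fixed_disc_deformations (gram_matrix Q) =
           (\<lambda>M. transpose Q ** M ** Q) ` {M. transpose M = M \<and> trace M = 0}"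
proof -
  obtain R where R: "Q ** R = mat 1" "R ** Q = mat 1"
    using assms by (auto simp: invertible_def)
  have RT: "transpose Q ** transpose R = mat 1" "transpose R ** transpose Q = mat 1"
    using R by (simp_all add: matrix_transpose_mul[symmetric])
  have cancel: "X ** Q ** R = X" "X ** R ** Q = X"
      "X ** transpose Q ** transpose R = X" "X ** transpose R ** transpose Q = X" for X :: "real ^ 'n ^ 'n"
    using R RT by (simp_all add: matrix_mul_assoc[symmetric])
  have "gram_matrix Q ** (R ** transpose R) = mat 1" "(R ** transpose R) ** gram_matrix Q = mat 1"
    using R RT by (simp_all add: gram_matrix_def matrix_mul_assoc cancel)
  then have inv: "matrix_inv (gram_matrix Q) = R ** transpose R"
    by (rule matrix_inv_eqI)
  have trace: "trace (transpose R ** B ** R) = trace (B ** matrix_inv (gram_matrix Q))" for B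
    using trace_mul_sym[of "transpose R" "B ** R"] by (simp add: inv matrix_mul_assoc)
  show ?thesis
  proof (intro equalityI subsetI)
    fix B assume B: "B \<in> fixed_disc_deformations (gram_matrix Q)"
    show "B \<in> (\<lambda>M. transpose Q ** M ** Q) ` {M. transpose M = M \<and> trace M = 0}"
    proof (rule image_eqI)
      show "B = transpose Q ** (transpose R ** B ** R) ** Q"
        using RT by (simp add: matrix_mul_assoc cancel)
      show "transpose R ** B ** R \<in> {M. transpose M = M \<and> trace M = 0}"
        using B trace[of B] by (simp add: fixed_disc_deformations_def matrix_transpose_mul matrix_mul_assoc)
    qed
  next
    fix B assume "B \<in> (\<lambda>M. transpose Q ** M ** Q) ` {M. transpose M = M \<and> trace M = 0}"
    then obtain M where M: "transpose M = M" "trace M = 0" "B = transpose Q ** M ** Q"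
      by auto
    have "transpose R ** B ** R = M"
      using RT by (simp add: M(3) matrix_mul_assoc cancel)
    then show "B \<in> fixed_disc_deformations (gram_matrix Q)"
      using M trace[of B] by (simp add: fixed_disc_deformations_def matrix_transpose_mul matrix_mul_assoc)
  qed
qed

definition theta_term :: "complex \<Rightarrow> complex \<Rightarrow> complex" where
  "theta_term z u = exp (2 * of_real pi * \<i> * of_real ((norm u)\<^sup>2) * z)"

lemma norm_theta_term: "norm (theta_term z u) = exp (- (2 * pi * Im z) * (norm u)\<^sup>2)"
  by (simp add: theta_term_def mult_ac)

lemma lattice_theta_summable:
  assumes "lattice_basis \<Lambda> Q" "Im z > 0"
    and h: "\<And>u. norm (h u) \<le> K * ((norm u)\<^sup>2) ^ n"
  shows "(\<lambda>u. h u * theta_term z u) summable_on \<Lambda>"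
proof (rule abs_summable_summable, rule Infinite_Sum.abs_summable_on_comparison_test')
  show "(\<lambda>u. K * (((norm u)\<^sup>2) ^ n * exp (- (2 * pi * Im z) * (norm u)\<^sup>2))) summable_on \<Lambda>"
    using assms by (intro summable_on_cmult_right lattice_gaussian_summable) auto
  show "norm (h u * theta_term z u) \<le> K * (((norm u)\<^sup>2) ^ n * exp (- (2 * pi * Im z) * (norm u)\<^sup>2))" for u
    using mult_right_mono[OF h[of u], of "norm (theta_term z u)"]
    by (simp add: norm_mult norm_theta_term mult.assoc)
qed

text \<open>
  The factor \<open>1 / (2 \<pi> i z)\<close> in the definition of the derivative cancels the one produced by
  differentiating the exponentials.
\<close>

lemma Theta_deriv_eq:
  assumes \<Lambda>: "lattice_basis \<Lambda> Q" and z: "Im z > 0"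
    and B: "\<And>l. qform B l = Re (a * (plane_to_complex (Q *v real_vec l))\<^sup>2)"
  shows "Theta_deriv B (gram_matrix Q) z = (\<Sum>\<^sub>\<infinity>u\<in>\<Lambda>. of_real (Re (a * u\<^sup>2)) * theta_term z u)"
proof -
  define w where "w u = 2 * of_real pi * \<i> * of_real (Re (a * u\<^sup>2)) * z" for u
  define K where "K = 2 * pi * norm a * norm z"
  \<comment> \<open>For deformation parameters up to \<open>e\<close>, the perturbation uses up at most half of the exponential
    decay of the theta terms; \<open>K + 1\<close> instead of \<open>K\<close> avoids dividing by zero when \<open>a = 0\<close>.\<close>
  define e where "e = pi * Im z / (K + 1)"
  have K: "K \<ge> 0"
    by (simp add: K_def)
  then have e: "e > 0" "e * K \<le> pi * Im z"
    using z by (auto simp: e_def field_simps intro!: divide_pos_pos)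
  have "norm (w u) \<le> K * (norm u)\<^sup>2" for u
  proof -
    have "norm (w u) = 2 * pi * norm z * \<bar>Re (a * u\<^sup>2)\<bar>"
      by (simp add: w_def norm_mult del: times_complex.sel)
    also have "\<dots> \<le> 2 * pi * norm z * norm (a * u\<^sup>2)"
      by (intro mult_left_mono abs_Re_le_cmod) auto
    finally show ?thesis
      by (simp add: K_def norm_mult norm_power mult_ac)
  qed
  note w = this
  have "Theta (gram_matrix Q + t *\<^sub>R B) z = (\<Sum>\<^sub>\<infinity>u\<in>\<Lambda>. theta_term z u * exp (of_real t * w u))" for t
  proof -
    have q: "qform (gram_matrix Q + t *\<^sub>R B) l = qform (gram_matrix Q) l + t * qform B l" for l
      by (simp add: qform_def matrix_vector_mult_add_rdistrib inner_add_right scaleR_matrix_vector_assoc[symmetric])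
    show ?thesis
      unfolding Theta_def infsum_reindex_bij_betw[OF lattice_basis_bij_betw[OF \<Lambda>], symmetric]
      by (intro infsum_cong)
         (simp add: q qform_gram_matrix B theta_term_def w_def exp_add[symmetric] algebra_simps)
  qed
  then have "((\<lambda>t::real. Theta (gram_matrix Q + t *\<^sub>R B) z) has_vector_derivative
      (\<Sum>\<^sub>\<infinity>u\<in>\<Lambda>. theta_term z u * w u)) (at 0)"
  proof (simp only:, intro has_vector_derivative_infsum_exp[OF e(1)])
    show "theta_term z summable_on \<Lambda>"
      using lattice_theta_summable[OF \<Lambda> z, of "\<lambda>_. 1" 1 0] by simp
    show "(\<lambda>u. theta_term z u * w u) summable_on \<Lambda>"
      using lattice_theta_summable[OF \<Lambda> z, of w K 1] w by (simp add: mult.commute)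
    show "(\<lambda>u. norm (theta_term z u) * (norm (w u))\<^sup>2 * exp (e * norm (w u))) summable_on \<Lambda>"
    proof (rule summable_on_comparison_test)
      show "(\<lambda>u. K\<^sup>2 * (((norm u)\<^sup>2)\<^sup>2 * exp (- (pi * Im z) * (norm u)\<^sup>2))) summable_on \<Lambda>"
        using z by (intro summable_on_cmult_right lattice_gaussian_summable[OF \<Lambda>]) auto
      fix u
      have "e * norm (w u) \<le> e * (K * (norm u)\<^sup>2)"
        using e w by (intro mult_left_mono) auto
      also have "\<dots> \<le> pi * Im z * (norm u)\<^sup>2"
        using mult_right_mono[OF e(2), of "(norm u)\<^sup>2"] by (simp add: mult_ac)
      finally have "norm (theta_term z u) * exp (e * norm (w u))
          \<le> exp (- (2 * pi * Im z) * (norm u)\<^sup>2) * exp (pi * Im z * (norm u)\<^sup>2)"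
        by (simp add: norm_theta_term)
      also have "\<dots> = exp (- (pi * Im z) * (norm u)\<^sup>2)"
        by (simp add: exp_add[symmetric])
      finally have "(norm (w u))\<^sup>2 * (norm (theta_term z u) * exp (e * norm (w u)))
          \<le> (K * (norm u)\<^sup>2)\<^sup>2 * exp (- (pi * Im z) * (norm u)\<^sup>2)"
        using w by (intro mult_mono power_mono) auto
      then show "norm (theta_term z u) * (norm (w u))\<^sup>2 * exp (e * norm (w u))
          \<le> K\<^sup>2 * (((norm u)\<^sup>2)\<^sup>2 * exp (- (pi * Im z) * (norm u)\<^sup>2))"
        by (simp add: power_mult_distrib mult_ac)
    qed auto
  qed
  from vector_derivative_at[OF this]
  have "Theta_deriv B (gram_matrix Q) z =
      1 / (2 * of_real pi * \<i> * z) * (\<Sum>\<^sub>\<infinity>u\<in>\<Lambda>. theta_term z u * w u)"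
    by (simp add: Theta_deriv_def)
  also have "\<dots> = (\<Sum>\<^sub>\<infinity>u\<in>\<Lambda>. 1 / (2 * of_real pi * \<i> * z) * (theta_term z u * w u))"
    by (rule infsum_cmult_right'[symmetric])
  also have "\<dots> = (\<Sum>\<^sub>\<infinity>u\<in>\<Lambda>. of_real (Re (a * u\<^sup>2)) * theta_term z u)"
  proof (rule infsum_cong)
    fix u
    have "z \<noteq> 0"
      using z by auto
    then show "1 / (2 * of_real pi * \<i> * z) * (theta_term z u * w u) = of_real (Re (a * u\<^sup>2)) * theta_term z u"
      unfolding w_def by (simp del: Re_complex_of_real times_complex.sel)
  qed
  finally show ?thesis .
qed

text \<open>
  The theta series of the lattice weighted with the harmonic polynomial \<open>u\<^sup>2\<close>.
\<close>

definition lattice_moment :: "complex set \<Rightarrow> complex \<Rightarrow> complex" where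
  "lattice_moment \<Lambda> z = (\<Sum>\<^sub>\<infinity>u\<in>\<Lambda>. u\<^sup>2 * theta_term z u)"

lemma cnj_theta_term: "cnj (theta_term z u) = theta_term (- cnj z) u"
  by (simp add: theta_term_def exp_cnj)

text \<open>
  The forms \<open>Re (u\<^sup>2)\<close> and \<open>Re (- i u\<^sup>2) = Im (u\<^sup>2)\<close> recover \<open>u\<^sup>2\<close>. In the other direction \<open>Re (a u\<^sup>2)\<close> also
  involves the conjugate of \<open>u\<^sup>2\<close>, whose sum at \<open>z\<close> is the conjugate of the moment at \<open>- cnj z\<close>, again a
  point of the upper half plane.
\<close>

lemma Theta_differential_vanishes_iff_moment:
  assumes \<Lambda>: "lattice_basis \<Lambda> Q"
  shows "Theta_differential_vanishes (gram_matrix Q) \<longleftrightarrow> (\<forall>z. Im z > 0 \<longrightarrow> lattice_moment \<Lambda> z = 0)"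
proof
  assume van: "Theta_differential_vanishes (gram_matrix Q)"
  have form: "(\<Sum>\<^sub>\<infinity>u\<in>\<Lambda>. of_real (Re (a * u\<^sup>2)) * theta_term z u) = 0" if z: "Im z > 0" for a z
  proof -
    define M :: "real ^ 2 ^ 2" where "M = vector [vector [Re a, - Im a], vector [- Im a, - Re a]]"
    have M: "transpose M = M" "trace M = 0" "Complex (M $ 1 $ 1) (- (M $ 1 $ 2)) = a"
      by (auto simp: M_def transpose_def vec_eq_iff forall_2 trace_def sum_2)
    let ?B = "transpose Q ** M ** Q"
    have "?B \<in> fixed_disc_deformations (gram_matrix Q)"
      using \<Lambda> M fixed_disc_deformations_gram_matrix[of Q] by (auto simp: lattice_basis_def)
    then have "Theta_deriv ?B (gram_matrix Q) z = 0"
      using van z by (auto simp: Theta_differential_vanishes_def)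
    moreover have "qform ?B l = Re (a * (plane_to_complex (Q *v real_vec l))\<^sup>2)" for l
      unfolding quadratic_form_congruence traceless_symmetric_form[OF M(1,2)] M(3) ..
    ultimately show ?thesis
      using Theta_deriv_eq[OF \<Lambda> z] by metis
  qed
  show "\<forall>z. Im z > 0 \<longrightarrow> lattice_moment \<Lambda> z = 0"
  proof (intro allI impI)
    fix z :: complex assume z: "Im z > 0"
    have bound: "norm (complex_of_real (Re (a * u\<^sup>2))) \<le> norm a * ((norm u)\<^sup>2) ^ 1" for a u
      using abs_Re_le_cmod[of "a * u\<^sup>2"] by (simp add: norm_mult norm_power del: times_complex.sel)
    note summ = lattice_theta_summable[OF \<Lambda> z bound]
    have "lattice_moment \<Lambda> z = (\<Sum>\<^sub>\<infinity>u\<in>\<Lambda>. of_real (Re (1 * u\<^sup>2)) * theta_term z u +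
        \<i> * (of_real (Re (- \<i> * u\<^sup>2)) * theta_term z u))"
      unfolding lattice_moment_def
    proof (rule infsum_cong)
      fix u
      have "u\<^sup>2 = of_real (Re (1 * u\<^sup>2)) + \<i> * of_real (Re (- \<i> * u\<^sup>2))"
        by (simp add: complex_eq_iff)
      then show "u\<^sup>2 * theta_term z u = of_real (Re (1 * u\<^sup>2)) * theta_term z u +
          \<i> * (of_real (Re (- \<i> * u\<^sup>2)) * theta_term z u)"
        by (metis distrib_right mult.assoc)
    qed
    also have "\<dots> = 0"
      using form[OF z, of 1] form[OF z, of "- \<i>"] summ[of 1] summ[of "- \<i>"]
      by (subst infsum_add)
         (auto simp only: infsum_cmult_right' mult_zero_right add_0_right intro: summable_on_cmult_right)
    finally show "lattice_moment \<Lambda> z = 0" .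
  qed
next
  assume mom: "\<forall>z. Im z > 0 \<longrightarrow> lattice_moment \<Lambda> z = 0"
  show "Theta_differential_vanishes (gram_matrix Q)"
    unfolding Theta_differential_vanishes_def
  proof (intro ballI allI impI)
    fix B z assume B: "B \<in> fixed_disc_deformations (gram_matrix Q)" and z: "Im z > 0"
    obtain M where M: "transpose M = M" "trace M = 0" "B = transpose Q ** M ** Q"
      using B \<Lambda> fixed_disc_deformations_gram_matrix[of Q] by (auto simp: lattice_basis_def)
    define a where "a = Complex (M $ 1 $ 1) (- (M $ 1 $ 2))"
    have "qform B l = Re (a * (plane_to_complex (Q *v real_vec l))\<^sup>2)" for l
      unfolding M(3) quadratic_form_congruence traceless_symmetric_form[OF M(1,2)] a_def ..
    then have "Theta_deriv B (gram_matrix Q) z = (\<Sum>\<^sub>\<infinity>u\<in>\<Lambda>. of_real (Re (a * u\<^sup>2)) * theta_term z u)"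
      by (rule Theta_deriv_eq[OF \<Lambda> z])
    also have "\<dots> = (\<Sum>\<^sub>\<infinity>u\<in>\<Lambda>. a / 2 * (u\<^sup>2 * theta_term z u) + cnj a / 2 * ((cnj u)\<^sup>2 * theta_term z u))"
    proof (rule infsum_cong)
      fix u
      have "of_real (Re (a * u\<^sup>2)) = (a * u\<^sup>2 + cnj (a * u\<^sup>2)) / 2"
        by (simp only: complex_add_cnj) simp
      then show "of_real (Re (a * u\<^sup>2)) * theta_term z u =
          a / 2 * (u\<^sup>2 * theta_term z u) + cnj a / 2 * ((cnj u)\<^sup>2 * theta_term z u)"
        by (simp add: algebra_simps add_divide_distrib del: Re_complex_of_real times_complex.sel)
    qed
    also have "\<dots> = a / 2 * lattice_moment \<Lambda> z + cnj a / 2 * (\<Sum>\<^sub>\<infinity>u\<in>\<Lambda>. (cnj u)\<^sup>2 * theta_term z u)"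
    proof -
      have "(\<lambda>u. u\<^sup>2 * theta_term z u) summable_on \<Lambda>" "(\<lambda>u. (cnj u)\<^sup>2 * theta_term z u) summable_on \<Lambda>"
        by (rule lattice_theta_summable[OF \<Lambda> z, of _ 1 1]; simp add: norm_power)+
      then show ?thesis
        by (subst infsum_add) (auto simp only: lattice_moment_def infsum_cmult_right' intro: summable_on_cmult_right)
    qed
    also have "(\<Sum>\<^sub>\<infinity>u\<in>\<Lambda>. (cnj u)\<^sup>2 * theta_term z u) = cnj (lattice_moment \<Lambda> (- cnj z))"
      unfolding lattice_moment_def infsum_cnj[symmetric] by (simp add: cnj_theta_term)
    finally show "Theta_deriv B (gram_matrix Q) z = 0"
      using mom z by simp
  qed
qed

section \<open>The shortest vectors of a lattice with vanishing moment\<close>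

text \<open>
  A Dirichlet series that is zero for all large \<open>y\<close> has leading coefficient zero: multiplied by
  \<open>exp (y m)\<close>, all terms outside \<open>S\<close> together are \<open>O (exp (- y \<delta>))\<close>, while the terms in \<open>S\<close> do not
  depend on \<open>y\<close>.
\<close>

lemma leading_coefficient_zero:
  fixes c :: "'i \<Rightarrow> complex" and a :: "'i \<Rightarrow> real"
  assumes S: "finite S" "S \<subseteq> I" and "\<delta> > 0"
    and summ: "(\<lambda>i. norm (c i) * exp (- a i)) summable_on I"
    and lead: "\<And>i. i \<in> S \<Longrightarrow> a i = m"
    and gap: "\<And>i. i \<in> I - S \<Longrightarrow> a i \<ge> m + \<delta>"
    and zero: "\<And>y. y \<ge> 1 \<Longrightarrow> (\<Sum>\<^sub>\<infinity>i\<in>I. c i * of_real (exp (- y * a i))) = 0"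
  shows "sum c S = 0"
proof -
  define T where "T = (\<Sum>\<^sub>\<infinity>i\<in>I - S. norm (c i) * exp (- a i))"
  have bound: "norm (sum c S) \<le> T * exp (m + \<delta>) * exp (- (y * \<delta>))" if y: "y \<ge> 1" for y
  proof -
    let ?h = "\<lambda>i. c i * of_real (exp (- y * a i))"
    have summ': "(\<lambda>i. norm (c i) * exp (- a i)) summable_on I - S"
      using summ by (rule summable_on_subset) auto
    have le: "norm (?h i) \<le> exp (- (y - 1) * (m + \<delta>)) * (norm (c i) * exp (- a i))" if "i \<in> I - S" for i
    proof -
      have "(y - 1) * (m + \<delta>) \<le> (y - 1) * a i"
        using y gap[OF that] by (intro mult_left_mono) auto
      then have "exp (- y * a i) \<le> exp (- (y - 1) * (m + \<delta>)) * exp (- a i)"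
        by (simp add: exp_add[symmetric] algebra_simps)
      then have "norm (c i) * exp (- y * a i) \<le> norm (c i) * (exp (- (y - 1) * (m + \<delta>)) * exp (- a i))"
        by (rule mult_left_mono) simp
      then show ?thesis
        by (simp add: norm_mult mult_ac)
    qed
    have habs: "(\<lambda>i. norm (?h i)) summable_on I - S"
      by (rule Infinite_Sum.abs_summable_on_comparison_test'[OF summable_on_cmult_right[OF summ'] le])
    have "0 = (\<Sum>\<^sub>\<infinity>i\<in>S \<union> (I - S). ?h i)"
      using zero[OF y] S by (simp add: Un_absorb1)
    also have "\<dots> = sum ?h S + infsum ?h (I - S)"
      using S abs_summable_summable[OF habs] by (subst infsum_Un_disjoint) auto
    also have "sum ?h S = of_real (exp (- y * m)) * sum c S"
      unfolding sum_distrib_left by (intro sum.cong) (auto simp: lead)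
    finally have "of_real (exp (- y * m)) * sum c S = - infsum ?h (I - S)"
      by (simp add: eq_neg_iff_add_eq_0)
    then have "exp (- y * m) * norm (sum c S) = norm (infsum ?h (I - S))"
      by (metis norm_minus_cancel norm_mult norm_of_real abs_exp_cancel)
    also have "\<dots> \<le> (\<Sum>\<^sub>\<infinity>i\<in>I - S. norm (?h i))"
      by (rule norm_infsum_bound[OF habs])
    also have "\<dots> \<le> (\<Sum>\<^sub>\<infinity>i\<in>I - S. exp (- (y - 1) * (m + \<delta>)) * (norm (c i) * exp (- a i)))"
      by (rule infsum_mono[OF habs summable_on_cmult_right[OF summ'] le])
    also have "\<dots> = exp (- (y - 1) * (m + \<delta>)) * T"
      by (simp add: infsum_cmult_right' T_def)
    finally have "exp (y * m) * (exp (- y * m) * norm (sum c S)) \<le> exp (y * m) * (exp (- (y - 1) * (m + \<delta>)) * T)"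
      by (rule mult_left_mono) auto
    moreover have "exp (y * m) * exp (- y * m) = 1"
      by (simp add: exp_add[symmetric])
    moreover have "exp (y * m) * exp (- (y - 1) * (m + \<delta>)) = exp (m + \<delta>) * exp (- (y * \<delta>))"
      by (simp add: exp_add[symmetric] algebra_simps)
    ultimately show ?thesis
      by (metis mult.assoc mult.commute mult_1)
  qed
  have "((\<lambda>y. T * exp (m + \<delta>) * exp (- (y * \<delta>))) \<longlongrightarrow> T * exp (m + \<delta>) * 0) at_top"
    using \<open>\<delta> > 0\<close>
    by (intro tendsto_mult tendsto_const filterlim_compose[OF exp_at_bot]
          filterlim_compose[OF filterlim_uminus_at_bot_at_top] filterlim_at_top_mult_tendsto_pos[OF tendsto_const])
       (auto simp: filterlim_ident)
  moreover have "eventually (\<lambda>y. norm (sum c S) \<le> T * exp (m + \<delta>) * exp (- (y * \<delta>))) at_top"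
    using eventually_ge_at_top[of 1] by eventually_elim (rule bound)
  ultimately have "norm (sum c S) \<le> T * exp (m + \<delta>) * 0"
    by (intro tendsto_lowerbound) auto
  then show ?thesis
    by simp
qed

lemma lattice_integer_combination:
  assumes "lattice_basis \<Lambda> Q" "u \<in> \<Lambda>" "v \<in> \<Lambda>"
  shows "of_int m * u + of_int n * v \<in> \<Lambda>"
proof -
  obtain k l where kl: "u = plane_to_complex (Q *v real_vec k)" "v = plane_to_complex (Q *v real_vec l)"
    using assms by (auto simp: lattice_basis_def)
  have "of_int m * u + of_int n * v = plane_to_complex (Q *v real_vec (\<chi> i. m * k $ i + n * l $ i))"
    by (simp add: kl plane_to_complex_def complex_eq_iff matrix_vector_mult_def real_vec_def sum_2 algebra_simps)
  then show ?thesis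
    using assms(1) by (auto simp: lattice_basis_def)
qed

lemma lattice_nonzero_vector:
  assumes "lattice_basis \<Lambda> Q"
  obtains v where "v \<in> \<Lambda>" "v \<noteq> 0"
proof -
  have inj: "inj_on (\<lambda>l. plane_to_complex (Q *v real_vec l)) UNIV"
    using lattice_basis_bij_betw[OF assms] by (rule bij_betw_imp_inj_on)
  have "(1 :: int ^ 2) \<noteq> 0"
    by (simp add: vec_eq_iff)
  then have "plane_to_complex (Q *v real_vec 1) \<noteq> plane_to_complex (Q *v real_vec 0)"
    using inj by (auto dest: injD)
  also have "plane_to_complex (Q *v real_vec 0) = 0"
    by (simp add: plane_to_complex_def real_vec_def complex_eq_iff matrix_vector_mult_def)
  finally show ?thesis
    using that assms by (auto simp: lattice_basis_def)
qed

text \<open>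
  The bound \<open>m'\<close> separates the shortest vectors uniformly from all longer ones. This gap makes the
  remaining terms of the series negligible on the imaginary axis.
\<close>

lemma lattice_minimum:
  assumes \<Lambda>: "lattice_basis \<Lambda> Q"
  obtains m m' where "0 < m" "m < m'" "\<exists>u\<in>\<Lambda>. norm u = m"
    "\<And>u. u \<in> \<Lambda> \<Longrightarrow> u \<noteq> 0 \<Longrightarrow> m \<le> norm u"
    "\<And>u. u \<in> \<Lambda> \<Longrightarrow> m < norm u \<Longrightarrow> m' \<le> norm u"
proof -
  obtain v where v: "v \<in> \<Lambda>" "v \<noteq> 0"
    using lattice_nonzero_vector[OF \<Lambda>] .
  define F where "F = {u \<in> \<Lambda>. norm u \<le> norm v} - {0}"
  have F: "finite F" "v \<in> F"
    using lattice_finite_ball[OF \<Lambda>] v by (auto simp: F_def)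
  define m where "m = Min (norm ` F)"
  have "m \<in> norm ` F"
    unfolding m_def using F by (intro Min_in) auto
  then have m: "m > 0" "\<exists>u\<in>\<Lambda>. norm u = m" "m \<le> norm v"
    by (auto simp: F_def)
  have min: "m \<le> norm u" if "u \<in> \<Lambda>" "u \<noteq> 0" for u
  proof (cases "norm u \<le> norm v")
    case True
    then show ?thesis
      using that F by (auto simp: m_def F_def intro!: Min_le)
  qed (use m in linarith)
  define G where "G = insert (m + 1) (norm ` {u \<in> \<Lambda>. norm u \<le> m + 1 \<and> m < norm u})"
  have "finite {u \<in> \<Lambda>. norm u \<le> m + 1 \<and> m < norm u}"
    by (rule finite_subset[OF _ lattice_finite_ball[OF \<Lambda>, of "m + 1"]]) auto
  then have G: "finite G" "G \<noteq> {}"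
    by (auto simp: G_def)
  have "m < Min G"
    using G by (subst Min_gr_iff) (auto simp: G_def)
  moreover have "Min G \<le> norm u" if "u \<in> \<Lambda>" "m < norm u" for u
  proof (cases "norm u \<le> m + 1")
    case True
    then show ?thesis
      using G that by (intro Min_le) (auto simp: G_def)
  next
    case False
    moreover have "Min G \<le> m + 1"
      using G by (intro Min_le) (auto simp: G_def)
    ultimately show ?thesis
      by linarith
  qed
  ultimately show ?thesis
    using that m(1,2) min by blast
qed

text \<open>
  On the imaginary axis the moment is a Dirichlet series in \<open>exp (- 2 \<pi> y)\<close> with exponents \<open>|u|\<^sup>2\<close>. The
  zero vector, whose exponent would be the smallest one, has coefficient \<open>0\<close> and is left out.
\<close>

lemma shortest_vectors_balanced:
  assumes \<Lambda>: "lattice_basis \<Lambda> Q"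
    and mom: "\<And>z. Im z > 0 \<Longrightarrow> lattice_moment \<Lambda> z = 0"
  obtains m where "0 < m" "\<exists>u\<in>\<Lambda>. norm u = m"
    "\<And>u. u \<in> \<Lambda> \<Longrightarrow> u \<noteq> 0 \<Longrightarrow> m \<le> norm u"
    "(\<Sum>u | u \<in> \<Lambda> \<and> norm u = m. u\<^sup>2) = 0"
proof -
  obtain m m' where m: "0 < m" "m < m'" "\<exists>u\<in>\<Lambda>. norm u = m"
    "\<And>u. u \<in> \<Lambda> \<Longrightarrow> u \<noteq> 0 \<Longrightarrow> m \<le> norm u"
    "\<And>u. u \<in> \<Lambda> \<Longrightarrow> m < norm u \<Longrightarrow> m' \<le> norm u"
    using lattice_minimum[OF \<Lambda>] by metis
  let ?S = "{u. u \<in> \<Lambda> \<and> norm u = m}"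
  have "sum (\<lambda>u. u\<^sup>2) ?S = 0"
  proof (rule leading_coefficient_zero[where I = "\<Lambda> - {0}" and a = "\<lambda>u. 2 * pi * (norm u)\<^sup>2"
        and m = "2 * pi * m\<^sup>2" and \<delta> = "2 * pi * (m'\<^sup>2 - m\<^sup>2)"])
    show "finite ?S"
      by (rule finite_subset[OF _ lattice_finite_ball[OF \<Lambda>, of m]]) auto
    show "?S \<subseteq> \<Lambda> - {0}"
      using m by auto
    show "2 * pi * (m'\<^sup>2 - m\<^sup>2) > 0"
      using m by (auto simp: power_strict_mono)
    have "(\<lambda>u. norm (u\<^sup>2) * exp (- (2 * pi * (norm u)\<^sup>2))) summable_on \<Lambda>"
      using lattice_gaussian_summable[OF \<Lambda>, of "2 * pi" 1] by (simp add: norm_power)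
    then show "(\<lambda>u. norm (u\<^sup>2) * exp (- (2 * pi * (norm u)\<^sup>2))) summable_on \<Lambda> - {0}"
      by (rule summable_on_subset) auto
    show "2 * pi * (norm u)\<^sup>2 = 2 * pi * m\<^sup>2" if "u \<in> ?S" for u
      using that by simp
    show "2 * pi * m\<^sup>2 + 2 * pi * (m'\<^sup>2 - m\<^sup>2) \<le> 2 * pi * (norm u)\<^sup>2" if "u \<in> \<Lambda> - {0} - ?S" for u
    proof -
      have "m' \<le> norm u"
        using that m(4)[of u] m(5)[of u] by force
      then have "m'\<^sup>2 \<le> (norm u)\<^sup>2"
        using m by (intro power_mono) auto
      then show ?thesis
        by (simp add: algebra_simps)
    qed
    show "(\<Sum>\<^sub>\<infinity>u\<in>\<Lambda> - {0}. u\<^sup>2 * of_real (exp (- y * (2 * pi * (norm u)\<^sup>2)))) = 0" if "y \<ge> 1" for y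
    proof -
      have "theta_term (\<i> * of_real y) u = of_real (exp (- y * (2 * pi * (norm u)\<^sup>2)))" for u
        by (simp add: theta_term_def exp_of_real[symmetric] mult_ac)
      then have "(\<Sum>\<^sub>\<infinity>u\<in>\<Lambda> - {0}. u\<^sup>2 * of_real (exp (- y * (2 * pi * (norm u)\<^sup>2)))) = lattice_moment \<Lambda> (\<i> * of_real y)"
        unfolding lattice_moment_def by (intro infsum_cong_neutral) auto
      also have "\<dots> = 0"
        using that by (intro mom) auto
      finally show ?thesis .
    qed
  qed
  with m that show ?thesis
    by blast
qed

section \<open>The Gaussian and the Eisenstein integers\<close>

text \<open>
  The group generated by \<open>1\<close> and \<open>\<omega>\<close>. The relevant values of \<open>\<omega>\<close> satisfy \<open>\<omega>\<^sup>2 = t \<omega> - 1\<close> with an integer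
  \<open>t\<close> (\<open>0\<close> for the Gaussian and \<open>1\<close> for the Eisenstein integers), which makes it a ring.
\<close>

definition int_span :: "complex \<Rightarrow> complex set" where
  "int_span \<omega> = {of_int m + of_int n * \<omega> | m n. True}"

lemma int_span_closed:
  assumes "x \<in> int_span \<omega>" "y \<in> int_span \<omega>"
  shows "of_int a * x + of_int b * y \<in> int_span \<omega>"
proof -
  obtain m n m' n' where "x = of_int m + of_int n * \<omega>" "y = of_int m' + of_int n' * \<omega>"
    using assms by (auto simp: int_span_def)
  then have "of_int a * x + of_int b * y = of_int (a * m + b * m') + of_int (a * n + b * n') * \<omega>"
    by (simp add: algebra_simps)
  then show ?thesis
    unfolding int_span_def by blast
qed

text \<open>
  For an imaginary quadratic integer \<open>\<omega>\<close> of trace \<open>t\<close>, the number \<open>t - \<omega>\<close> is the conjugate of \<open>\<omega>\<close>, so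
  the span does not depend on the choice between the two.
\<close>

lemma int_span_reflect: "int_span (of_int t - \<omega>) = int_span \<omega>"
proof -
  have sub: "int_span (of_int t - \<nu>) \<subseteq> int_span \<nu>" for \<nu>
  proof
    fix x assume "x \<in> int_span (of_int t - \<nu>)"
    then obtain m n where "x = of_int m + of_int n * (of_int t - \<nu>)"
      by (auto simp: int_span_def)
    then have "x = of_int (m + n * t) + of_int (- n) * \<nu>"
      by (simp add: algebra_simps)
    then show "x \<in> int_span \<nu>"
      unfolding int_span_def by blast
  qed
  show ?thesis
    using sub[of \<omega>] sub[of "of_int t - \<omega>"] by auto
qed

lemma int_span_cnj: "cnj ` int_span \<omega> = int_span (cnj \<omega>)"
  by (auto simp: int_span_def image_def) (metis complex_cnj_add complex_cnj_mult complex_cnj_of_int)+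

lemma int_span_mult:
  assumes "\<omega>\<^sup>2 = of_int t * \<omega> - 1" "x \<in> int_span \<omega>"
  shows "\<omega> * x \<in> int_span \<omega>"
proof -
  obtain m n where x: "x = of_int m + of_int n * \<omega>"
    using assms by (auto simp: int_span_def)
  have "\<omega> * x = of_int m * \<omega> + of_int n * \<omega>\<^sup>2"
    by (simp add: x algebra_simps power2_eq_square)
  also have "\<dots> = of_int (- n) + of_int (m + n * t) * \<omega>"
    by (simp add: assms(1) algebra_simps)
  finally show ?thesis
    unfolding int_span_def by blast
qed

lemma adjoin_int_eq_int_span:
  assumes "\<omega>\<^sup>2 = of_int t * \<omega> - 1"
  shows "adjoin_int \<omega> = int_span \<omega>"
proof (intro equalityI subsetI)
  fix x assume "x \<in> adjoin_int \<omega>"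
  then obtain p where x: "x = poly (map_poly of_int p) \<omega>"
    by (auto simp: adjoin_int_def)
  show "x \<in> int_span \<omega>"
    unfolding x
  proof (induction p)
    case 0
    show ?case
      unfolding int_span_def by (auto intro!: exI[of _ 0])
  next
    case (pCons a p)
    have "of_int a + of_int 0 * \<omega> \<in> int_span \<omega>"
      unfolding int_span_def by blast
    then show ?case
      using int_span_closed[OF _ int_span_mult[OF assms pCons.IH], of "of_int a" 1 1]
      by (simp add: map_poly_pCons)
  qed
next
  fix x assume "x \<in> int_span \<omega>"
  then obtain m n where "x = of_int m + of_int n * \<omega>"
    by (auto simp: int_span_def)
  then have "x = poly (map_poly of_int [:m, n:]) \<omega>"
    by (simp add: map_poly_pCons)
  then show "x \<in> adjoin_int \<omega>"
    by (auto simp: adjoin_int_def)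
qed

abbreviation eisenstein_unit :: complex where
  "eisenstein_unit \<equiv> Complex (1 / 2) (sqrt 3 / 2)"

lemma csqrt_minus_three: "(1 + csqrt (- 3)) / 2 = eisenstein_unit"
  by (simp add: complex_eq_iff csqrt.code real_sqrt_divide)

lemma eisenstein_unit_square: "eisenstein_unit\<^sup>2 = of_int 1 * eisenstein_unit - 1"
  by (simp add: complex_eq_iff power2_eq_square field_simps)

lemma gaussian_integers_eq: "gaussian_integers = int_span \<i>"
  unfolding gaussian_integers_def by (rule adjoin_int_eq_int_span[of _ 0]) simp

lemma eisenstein_integers_eq: "eisenstein_integers = int_span eisenstein_unit"
  unfolding eisenstein_integers_def csqrt_minus_three
  by (rule adjoin_int_eq_int_span[OF eisenstein_unit_square])

section \<open>Lattices with balanced shortest vectors\<close>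

text \<open>
  The shape of \<open>\<Lambda>\<close> is the ratio \<open>\<omega>\<close> of two shortest vectors that are not parallel. All steps use that
  \<open>|x + y \<omega>|\<^sup>2 = x\<^sup>2 + y\<^sup>2 + 2 x y c\<close> with \<open>0 \<le> c \<le> 1/2\<close>: rounding \<open>x\<close> and \<open>y\<close> shows that the two vectors
  generate, since a remainder has squared length at most \<open>3/4\<close>, and solving for the value \<open>1\<close> in
  integers lists the shortest vectors.
\<close>

lemma balanced_shortest_vectors_imp_gaussian_or_eisenstein:
  fixes \<Lambda> :: "complex set"
  assumes closed: "\<And>u v m n. u \<in> \<Lambda> \<Longrightarrow> v \<in> \<Lambda> \<Longrightarrow> of_int m * u + of_int n * v \<in> \<Lambda>"
    and m: "0 < m" "\<exists>u\<in>\<Lambda>. norm u = m" "\<And>u. u \<in> \<Lambda> \<Longrightarrow> u \<noteq> 0 \<Longrightarrow> m \<le> norm u"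
    and bal: "(\<Sum>u | u \<in> \<Lambda> \<and> norm u = m. u\<^sup>2) = 0"
  obtains v where "v \<noteq> 0" "\<Lambda> = (*) v ` int_span \<i> \<or> \<Lambda> = (*) v ` int_span eisenstein_unit"
proof -
  let ?S = "{u. u \<in> \<Lambda> \<and> norm u = m}"
  have neg: "- u \<in> \<Lambda>" if "u \<in> \<Lambda>" for u
    using closed[OF that that, of "-1" 0] by simp
  obtain v where v: "v \<in> \<Lambda>" "norm v = m"
    using m by blast
  then have v0: "v \<noteq> 0"
    using m by auto
  \<comment> \<open>A single pair \<open>\<plusminus>v\<close> of shortest vectors would have \<open>2 v\<^sup>2\<close> as its sum of squares.\<close>
  have "\<exists>w\<in>?S. w \<noteq> v \<and> w \<noteq> - v"
  proof (rule ccontr)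
    assume "\<not> ?thesis"
    then have "?S = {v, - v}"
      using v neg by auto
    then have "v\<^sup>2 + v\<^sup>2 = 0"
      using bal v0 by simp
    then show False
      using v0 by simp
  qed
  then obtain w0 where w0: "w0 \<in> ?S" "w0 \<noteq> v" "w0 \<noteq> - v"
    by blast
  define w where "w = (if Re (w0 / v) \<ge> 0 then w0 else - w0)"
  have w: "w \<in> \<Lambda>" "norm w = m" "w \<noteq> v" "w \<noteq> - v" "Re (w / v) \<ge> 0"
    using w0 neg by (auto simp: w_def)
  define \<omega> where "\<omega> = w / v"
  define c where "c = Re \<omega>"
  have w_eq: "w = v * \<omega>"
    using v0 by (simp add: \<omega>_def)
  have "norm \<omega> = 1"
    using v w m by (simp add: \<omega>_def norm_divide)
  then have \<omega>1: "c\<^sup>2 + (Im \<omega>)\<^sup>2 = 1"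
    by (simp add: cmod_def c_def)
  have c0: "c \<ge> 0"
    using w by (simp add: c_def \<omega>_def)
  have norm_comb: "(norm (of_real x + of_real y * \<omega>))\<^sup>2 = x\<^sup>2 + y\<^sup>2 + 2 * x * y * c" for x y :: real
  proof -
    have "(norm (of_real x + of_real y * \<omega>))\<^sup>2 = x\<^sup>2 + 2 * x * y * c + y\<^sup>2 * (c\<^sup>2 + (Im \<omega>)\<^sup>2)"
      unfolding cmod_power2 by (simp add: c_def power2_eq_square algebra_simps)
    then show ?thesis
      by (simp add: \<omega>1)
  qed
  \<comment> \<open>The difference of two distinct shortest vectors is at least as long as they are.\<close>
  have c_half: "c \<le> 1 / 2"
  proof -
    have "of_int (-1) * v + of_int 1 * w \<in> \<Lambda>"
      by (rule closed[OF v(1) w(1)])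
    then have "norm v \<le> norm (w - v)"
      using m(3)[of "w - v"] w v by simp
    also have "w - v = v * (of_real (-1) + of_real 1 * \<omega>)"
      by (simp add: w_eq algebra_simps)
    finally have "1 \<le> norm (of_real (-1) + of_real 1 * \<omega>)"
      using v0 by (simp add: norm_mult)
    then have "1\<^sup>2 \<le> (norm (of_real (-1) + of_real 1 * \<omega>))\<^sup>2"
      by (intro power_mono) auto
    then show ?thesis
      unfolding norm_comb by simp
  qed
  have Im0: "Im \<omega> \<noteq> 0"
  proof
    assume "Im \<omega> = 0"
    then have "c\<^sup>2 = 1"
      using \<omega>1 by simp
    then show False
      using c0 c_half by (simp add: power2_eq_1_iff)
  qed
  have span: "\<Lambda> = (*) v ` int_span \<omega>"
  proof (intro equalityI subsetI)
    fix u assume u: "u \<in> \<Lambda>"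
    define y where "y = Im (u / v) / Im \<omega>"
    define x where "x = Re (u / v) - y * c"
    define a where "a = round x"
    define b where "b = round y"
    have uv: "u / v = of_real x + of_real y * \<omega>"
      using Im0 by (simp add: complex_eq_iff x_def y_def c_def)
    define x' where "x' = x - of_int a"
    define y' where "y' = y - of_int b"
    have x': "\<bar>x'\<bar> \<le> 1 / 2" and y': "\<bar>y'\<bar> \<le> 1 / 2"
      using of_int_round_abs_le[of x] of_int_round_abs_le[of y]
      by (auto simp: x'_def y'_def a_def b_def abs_minus_commute)
    have "\<bar>x' * y'\<bar> \<le> 1 / 2 * (1 / 2)"
      unfolding abs_mult using x' y' by (intro mult_mono) auto
    moreover have "\<bar>x'\<bar>\<^sup>2 \<le> (1 / 2)\<^sup>2" "\<bar>y'\<bar>\<^sup>2 \<le> (1 / 2)\<^sup>2"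
      by (rule power_mono[OF x'] power_mono[OF y']; rule abs_ge_zero)+
    moreover have "2 * x' * y' * c \<le> \<bar>x' * y'\<bar>"
    proof -
      have "(2 * c) * (x' * y') \<le> (2 * c) * \<bar>x' * y'\<bar>"
        using c0 by (intro mult_left_mono) auto
      also have "\<dots> \<le> 1 * \<bar>x' * y'\<bar>"
        using c_half by (intro mult_right_mono) auto
      finally show ?thesis
        by (simp add: mult_ac)
    qed
    ultimately have "(norm (of_real x' + of_real y' * \<omega>))\<^sup>2 < 1\<^sup>2"
      unfolding norm_comb by (simp add: power2_eq_square)
    then have "norm (of_real x' + of_real y' * \<omega>) < 1"
      by (rule power_less_imp_less_base) simp
    then have small: "norm (v * (of_real x' + of_real y' * \<omega>)) < m"
      using v m by (simp add: norm_mult)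
    have "of_int (-1) * (of_int a * v + of_int b * w) + of_int 1 * u \<in> \<Lambda>"
      by (intro closed u v w)
    also have "of_int (-1) * (of_int a * v + of_int b * w) + of_int 1 * u = v * (u / v - of_int a - of_int b * \<omega>)"
      using v0 by (simp add: w_eq algebra_simps)
    also have "\<dots> = v * (of_real x' + of_real y' * \<omega>)"
      unfolding uv by (simp add: x'_def y'_def algebra_simps)
    finally have "v * (of_real x' + of_real y' * \<omega>) = 0"
      using small m(3) by force
    then have "of_real x' + of_real y' * \<omega> = 0"
      using v0 by simp
    then have "u / v = of_int a + of_int b * \<omega>"
      unfolding uv by (simp add: x'_def y'_def algebra_simps)
    then have "u = v * (of_int a + of_int b * \<omega>)"
      using v0 by (simp add: field_simps)
    then show "u \<in> (*) v ` int_span \<omega>"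
      unfolding int_span_def by blast
  next
    fix u assume "u \<in> (*) v ` int_span \<omega>"
    then obtain a b where "u = v * (of_int a + of_int b * \<omega>)"
      by (auto simp: int_span_def)
    then have "u = of_int a * v + of_int b * w"
      by (simp add: w_eq algebra_simps)
    then show "u \<in> \<Lambda>"
      using closed v w by simp
  qed
  show ?thesis
  proof (cases "c = 1 / 2")
    case True
    have "(Im \<omega>)\<^sup>2 = (sqrt 3 / 2)\<^sup>2"
      using \<omega>1 unfolding True by (simp add: power_divide)
    then have "Im \<omega> = sqrt 3 / 2 \<or> Im \<omega> = - (sqrt 3 / 2)"
      by (simp only: power2_eq_iff)
    then have "\<omega> = eisenstein_unit \<or> \<omega> = of_int 1 - eisenstein_unit"
      using True by (auto simp: complex_eq_iff c_def)
    then show ?thesis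
      using span v0 that int_span_reflect by metis
  next
    case False
    then have c: "2 * c < 1"
      using c_half by simp
    have "?S = {v, - v, w, - w}"
    proof (intro equalityI subsetI)
      fix u assume u: "u \<in> ?S"
      then obtain a b where ab: "u = v * (of_int a + of_int b * \<omega>)"
        using span by (auto simp: int_span_def)
      then have "norm (of_real (of_int a) + of_real (of_int b) * \<omega>) = 1"
        using u v m by (auto simp: norm_mult)
      then have n: "(real_of_int a)\<^sup>2 + (real_of_int b)\<^sup>2 + 2 * real_of_int a * real_of_int b * c = 1"
        using norm_comb[of "of_int a" "of_int b"] by simp
      have "a * b = 0"
      proof (rule ccontr)
        assume "a * b \<noteq> 0"
        then consider "a * b \<ge> 1" | "a * b \<le> -1"
          by linarith
        then show False
        proof cases
          case 1
          then have "real_of_int a * real_of_int b \<ge> 1"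
            by (metis of_int_1_le_iff of_int_mult)
          moreover from this have "(real_of_int a * real_of_int b) * c \<ge> 0"
            using c0 by simp
          moreover have "(real_of_int a)\<^sup>2 + (real_of_int b)\<^sup>2 \<ge> 2 * (real_of_int a * real_of_int b)"
            using sum_squares_bound[of "real_of_int a" "real_of_int b"] by simp
          ultimately show False
            using n by simp
        next
          case 2
          then have ab1: "real_of_int a * real_of_int b \<le> -1"
            by (metis of_int_le_iff of_int_minus of_int_1 of_int_mult)
          then have "(real_of_int a * real_of_int b) * 1 < (real_of_int a * real_of_int b) * (2 * c)"
            using c by (intro mult_strict_left_mono_neg) auto
          moreover have "(real_of_int a)\<^sup>2 + (real_of_int b)\<^sup>2 + 2 * (real_of_int a * real_of_int b) \<ge> 0"
            using zero_le_power2[of "real_of_int a + real_of_int b"] by (simp add: power2_sum)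
          ultimately show False
            using n ab1 by simp
        qed
      qed
      then consider "a = 0" | "b = 0"
        by auto
      then show "u \<in> {v, - v, w, - w}"
      proof cases
        case 1
        with n have "of_int (b\<^sup>2) = (1 :: real)"
          by simp
        then have "b = 1 \<or> b = -1"
          by (simp only: of_int_eq_1_iff power2_eq_1_iff)
        with 1 ab show ?thesis
          by (auto simp: w_eq)
      next
        case 2
        with n have "of_int (a\<^sup>2) = (1 :: real)"
          by simp
        then have "a = 1 \<or> a = -1"
          by (simp only: of_int_eq_1_iff power2_eq_1_iff)
        with 2 ab show ?thesis
          by auto
      qed
    qed (use v w neg in auto)
    moreover have "w \<noteq> 0" "- v \<noteq> w" "v \<noteq> - w"
      using w m by auto
    ultimately have "2 * (v\<^sup>2 + w\<^sup>2) = 0"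
      using bal v0 w(3) by (simp add: algebra_simps)
    then have "v\<^sup>2 + w\<^sup>2 = 0"
      by (metis mult_eq_0_iff zero_neq_numeral)
    then have "v\<^sup>2 * (1 + \<omega>\<^sup>2) = 0"
      by (simp add: w_eq algebra_simps power_mult_distrib)
    then have "\<omega>\<^sup>2 = \<i>\<^sup>2"
      using v0 by (simp add: add_eq_0_iff)
    then have "\<omega> = \<i> \<or> \<omega> = of_int 0 - \<i>"
      by (simp only: power2_eq_iff) simp
    then show ?thesis
      using span v0 that int_span_reflect by metis
  qed
qed

section \<open>Lattices with rotational symmetry\<close>

lemma moment_zero_of_rotation_invariant:
  assumes rot: "\<And>u. u \<in> \<Lambda> \<Longrightarrow> \<omega> * u \<in> \<Lambda>" "\<And>u. u \<in> \<Lambda> \<Longrightarrow> cnj \<omega> * u \<in> \<Lambda>"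
    and \<omega>: "norm \<omega> = 1" "\<omega>\<^sup>2 \<noteq> 1"
  shows "lattice_moment \<Lambda> z = 0"
proof -
  have unit: "cnj \<omega> * \<omega> = 1" "\<omega> * cnj \<omega> = 1"
    using \<omega> complex_norm_square[of \<omega>] by (simp_all add: mult.commute)
  have "lattice_moment \<Lambda> z = (\<Sum>\<^sub>\<infinity>u\<in>\<Lambda>. (\<omega> * u)\<^sup>2 * theta_term z (\<omega> * u))"
    unfolding lattice_moment_def
    by (rule infsum_reindex_bij_witness[of _ "\<lambda>u. \<omega> * u" "\<lambda>u. cnj \<omega> * u"])
       (use rot unit in \<open>auto simp: mult.assoc[symmetric]\<close>)
  also have "\<dots> = (\<Sum>\<^sub>\<infinity>u\<in>\<Lambda>. \<omega>\<^sup>2 * (u\<^sup>2 * theta_term z u))"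
    by (rule infsum_cong) (simp add: theta_term_def norm_mult \<omega> power_mult_distrib mult_ac)
  also have "\<dots> = \<omega>\<^sup>2 * lattice_moment \<Lambda> z"
    by (simp add: infsum_cmult_right' lattice_moment_def)
  finally have "(1 - \<omega>\<^sup>2) * lattice_moment \<Lambda> z = 0"
    by (simp add: algebra_simps)
  then show ?thesis
    using \<omega> by simp
qed

lemma orthogonal_transformation_complex:
  fixes \<phi> :: "complex \<Rightarrow> complex"
  assumes "orthogonal_transformation \<phi>"
  obtains a where "norm a = 1" "\<phi> = (\<lambda>x. a * x) \<or> \<phi> = (\<lambda>x. a * cnj x)"
proof -
  define a where "a = \<phi> 1"
  define b where "b = cnj a * \<phi> \<i>"
  have lin: "linear \<phi>" and norm: "\<And>x. norm (\<phi> x) = norm x"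
    using assms by (auto simp: orthogonal_transformation)
  have inner: "\<And>x y. \<phi> x \<bullet> \<phi> y = x \<bullet> y"
    using assms by (auto simp: orthogonal_transformation_def)
  have a: "norm a = 1"
    by (simp add: a_def norm)
  then have aa: "a * cnj a = 1"
    using complex_norm_square[of a] by simp
  have "norm b = 1"
    by (simp add: b_def norm_mult a norm)
  moreover have "Re b = 0"
    using inner[of 1 \<i>] by (simp add: b_def a_def inner_complex_def)
  ultimately have "b = \<i> \<or> b = - \<i>"
    by (auto simp: cmod_def complex_eq_iff abs_if split: if_splits)
  moreover have "\<phi> \<i> = a * b"
    by (simp add: b_def mult.assoc[symmetric] aa)
  ultimately have i: "\<phi> \<i> = a * \<i> \<or> \<phi> \<i> = a * (- \<i>)"
    by auto
  have "\<phi> x = of_real (Re x) * a + of_real (Im x) * \<phi> \<i>" for x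
  proof -
    have "x = Re x *\<^sub>R 1 + Im x *\<^sub>R \<i>"
      by (simp add: complex_eq_iff)
    then have "\<phi> x = \<phi> (Re x *\<^sub>R 1 + Im x *\<^sub>R \<i>)"
      by simp
    also have "\<dots> = Re x *\<^sub>R \<phi> 1 + Im x *\<^sub>R \<phi> \<i>"
      using lin by (simp add: linear_add linear_scale)
    finally show ?thesis
      by (simp add: a_def scaleR_conv_of_real)
  qed
  note \<phi>_eq = this
  from i show ?thesis
  proof
    assume i: "\<phi> \<i> = a * \<i>"
    have "\<phi> x = a * x" for x
    proof -
      have "\<phi> x = a * (of_real (Re x) + \<i> * of_real (Im x))"
        unfolding \<phi>_eq[of x] i by (simp add: algebra_simps)
      then show ?thesis
        by (simp only: complex_eq[symmetric])
    qed
    then show ?thesis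
      using that[OF a] by blast
  next
    assume i: "\<phi> \<i> = a * (- \<i>)"
    have "\<phi> x = a * cnj x" for x
    proof -
      have "\<phi> x = a * (of_real (Re (cnj x)) + \<i> * of_real (Im (cnj x)))"
        unfolding \<phi>_eq[of x] i by (simp add: algebra_simps)
      then show ?thesis
        by (simp only: complex_eq[symmetric])
    qed
    then show ?thesis
      using that[OF a] by blast
  qed
qed

lemma moment_zero_of_similar:
  assumes \<omega>: "\<omega>\<^sup>2 = of_int t * \<omega> - 1" "cnj \<omega> = of_int t - \<omega>" "\<omega>\<^sup>2 \<noteq> 1"
    and \<phi>: "orthogonal_transformation \<phi>"
    and \<Lambda>: "\<Lambda> = (\<lambda>x. c *\<^sub>R \<phi> x) ` int_span \<omega>"
  shows "lattice_moment \<Lambda> z = 0"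
proof -
  have cnj_span: "cnj ` int_span \<omega> = int_span \<omega>"
    by (simp only: int_span_cnj \<omega>(2) int_span_reflect)
  obtain a where "\<phi> = (\<lambda>x. a * x) \<or> \<phi> = (\<lambda>x. a * cnj x)"
    using orthogonal_transformation_complex[OF \<phi>] by metis
  then have \<Lambda>_eq: "\<Lambda> = (*) (of_real c * a) ` int_span \<omega>"
  proof
    assume "\<phi> = (\<lambda>x. a * x)"
    then show ?thesis
      by (simp add: \<Lambda> scaleR_conv_of_real mult.assoc)
  next
    assume "\<phi> = (\<lambda>x. a * cnj x)"
    then have "\<Lambda> = (*) (of_real c * a) ` cnj ` int_span \<omega>"
      by (simp add: \<Lambda> scaleR_conv_of_real mult.assoc image_image)
    then show ?thesis
      by (simp only: cnj_span)
  qed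
  have mult: "\<omega> * x \<in> int_span \<omega>" if "x \<in> int_span \<omega>" for x
    by (rule int_span_mult[OF \<omega>(1) that])
  have mult': "cnj \<omega> * x \<in> int_span \<omega>" if "x \<in> int_span \<omega>" for x
    using mult[of "cnj x"] that cnj_span by (metis complex_cnj_cnj complex_cnj_mult image_eqI)
  have "of_real ((norm \<omega>)\<^sup>2) = \<omega> * cnj \<omega>"
    by (rule complex_norm_square)
  also have "\<dots> = of_int t * \<omega> - \<omega>\<^sup>2"
    by (simp add: \<omega>(2) algebra_simps power2_eq_square)
  also have "\<dots> = of_real 1"
    by (simp add: \<omega>(1))
  finally have "(norm \<omega>)\<^sup>2 = 1"
    by (simp only: of_real_eq_iff)
  then have "norm \<omega> = 1"
    using norm_ge_zero[of \<omega>] by (simp only: power2_eq_1_iff) linarith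
  then show ?thesis
  proof (rule moment_zero_of_rotation_invariant[rotated 2])
    fix u assume "u \<in> \<Lambda>"
    then obtain x where "x \<in> int_span \<omega>" "u = (of_real c * a) * x"
      by (auto simp: \<Lambda>_eq)
    then show "\<omega> * u \<in> \<Lambda>" "cnj \<omega> * u \<in> \<Lambda>"
      using mult mult' unfolding \<Lambda>_eq by (metis image_eqI mult.left_commute)+
  qed (rule \<omega>(3))
qed

section \<open>Lattices with vanishing theta differential\<close>

theorem proposition5p2:
  fixes \<Lambda> :: "complex set" and Q A :: "real ^ 2 ^ 2"
  assumes "lattice_basis \<Lambda> Q"
    and "A = gram_matrix Q"
  shows "Theta_differential_vanishes A \<longleftrightarrow>
    (\<exists>(c::real) (\<phi> :: complex \<Rightarrow> complex) \<Lambda>\<^sub>0.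
        c > 0 \<and> orthogonal_transformation \<phi> \<and>
        \<Lambda>\<^sub>0 \<in> {gaussian_integers, eisenstein_integers} \<and>
        \<Lambda> = (\<lambda>x. c *\<^sub>R \<phi> x) ` \<Lambda>\<^sub>0)"
  (is "_ \<longleftrightarrow> ?similar")
proof -
  have "(\<forall>z. Im z > 0 \<longrightarrow> lattice_moment \<Lambda> z = 0) \<longleftrightarrow> ?similar"
  proof
    assume "\<forall>z. Im z > 0 \<longrightarrow> lattice_moment \<Lambda> z = 0"
    then have mom: "\<And>z. Im z > 0 \<Longrightarrow> lattice_moment \<Lambda> z = 0"
      by blast
    obtain m where m: "0 < m" "\<exists>u\<in>\<Lambda>. norm u = m"
      "\<And>u. u \<in> \<Lambda> \<Longrightarrow> u \<noteq> 0 \<Longrightarrow> m \<le> norm u"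
      "(\<Sum>u | u \<in> \<Lambda> \<and> norm u = m. u\<^sup>2) = 0"
      by (rule shortest_vectors_balanced[OF assms(1)], erule mom, rule that)
    obtain v where v0: "v \<noteq> 0"
      and "\<Lambda> = (*) v ` int_span \<i> \<or> \<Lambda> = (*) v ` int_span eisenstein_unit"
      by (rule balanced_shortest_vectors_imp_gaussian_or_eisenstein[OF _ m(1,2) _ m(4)],
          erule (1) lattice_integer_combination[OF assms(1)], erule (1) m(3), erule (1) that)
    then obtain \<Lambda>\<^sub>0 where v: "\<Lambda>\<^sub>0 \<in> {gaussian_integers, eisenstein_integers}" "\<Lambda> = (*) v ` \<Lambda>\<^sub>0"
      unfolding gaussian_integers_eq eisenstein_integers_eq by blast
    have orth: "orthogonal_transformation ((*) (sgn v))"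
      using v0 by (auto simp: orthogonal_transformation norm_mult norm_sgn bounded_linear.linear bounded_linear_mult_right)
    have "(\<lambda>x. norm v *\<^sub>R (sgn v * x)) = (*) v"
      using v0 by (simp add: fun_eq_iff sgn_div_norm)
    then have image: "\<Lambda> = (\<lambda>x. norm v *\<^sub>R (sgn v * x)) ` \<Lambda>\<^sub>0"
      using v(2) by (simp only:)
    have pos: "norm v > 0"
      using v0 by simp
    show ?similar
      by (intro exI[of _ "norm v"] exI[of _ "(*) (sgn v)"] exI[of _ "\<Lambda>\<^sub>0"] conjI) (fact pos orth v(1) image)+
  next
    assume ?similar
    then obtain c \<phi> \<Lambda>\<^sub>0 where s: "orthogonal_transformation \<phi>"
      "\<Lambda>\<^sub>0 \<in> {gaussian_integers, eisenstein_integers}" "\<Lambda> = (\<lambda>x. c *\<^sub>R \<phi> x) ` \<Lambda>\<^sub>0"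
      by blast
    then consider "\<Lambda>\<^sub>0 = int_span \<i>" | "\<Lambda>\<^sub>0 = int_span eisenstein_unit"
      by (auto simp: gaussian_integers_eq eisenstein_integers_eq)
    then show "\<forall>z. Im z > 0 \<longrightarrow> lattice_moment \<Lambda> z = 0"
    proof cases
      case 1
      then show ?thesis
        using s(3) by (intro allI impI moment_zero_of_similar[of \<i> 0, OF _ _ _ s(1)]) auto
    next
      case 2
      have "eisenstein_unit\<^sup>2 \<noteq> 1"
        by (simp only: eisenstein_unit_square) (simp add: complex_eq_iff)
      moreover have "cnj eisenstein_unit = of_int 1 - eisenstein_unit"
        by (simp add: complex_eq_iff)
      ultimately show ?thesis
        using s(3) 2 by (intro allI impI moment_zero_of_similar[OF eisenstein_unit_square _ _ s(1)]) auto
    qed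
  qed
  then show ?thesis
    by (simp add: assms(2) Theta_differential_vanishes_iff_moment[OF assms(1)])
qed

end
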